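(* Let $\mathbb{F}$ be an arbitrary field and let $A\in SL_2(\mathbb{F})$. Then every $2\times 2$ matrix $X$ over $\mathbb{F}$ satisfying $X^2=A$ belongs to $ESL_2(\mathbb{F})$.
   Context: $ESL_2(\mathbb{F})=\{M\in GL_2(\mathbb{F}) : \det M=1 \text{ or } \det M=-1\}$ is the extended special linear group. *)

theory Defs
  imports "HOL-Analysis.Analysis"
begin

definition GL2 :: "('a::field^2^2) set"
  where "GL2 = {M. invertible M}"

definition SL2 :: "('a::field^2^2) set"
  where "SL2 = {M \<in> GL2. det M = 1}"

definition ESL2 :: "('a::field^2^2) set"
  where "ESL2 = {M \<in> GL2. det M = 1 \<or> det M = - 1}"

end

theory Submission
  imports Defs
begin

text \<open>The determinant is multiplicative, so a square root \<open>X\<close> of \<open>A\<close>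
  has (det X)^2 = det A = 1. A field has no zero divisors, so (det X - 1)(det X + 1) = 0 leaves only
  the values 1 and -1, which coincide in characteristic 2.\<close>

theorem corollary9:
  fixes A :: "'a::field^2^2"
  assumes "A \<in> SL2"
  shows "\<forall>X :: 'a^2^2. X ** X = A \<longrightarrow> X \<in> ESL2"
proof (intro allI impI)
  fix X :: "'a^2^2"
  assume "X ** X = A"
  with assms have "det X * det X = 1"
    by (auto simp: SL2_def det_mul[symmetric])
  then have "det X = 1 \<or> det X = - 1"
    by (simp add: square_eq_1_iff)
  \<comment> \<open>Invertibility of \<open>X\<close> is not assumed: it follows because 1 and -1
    are both nonzero in a field.\<close>
  then show "X \<in> ESL2"
    by (auto simp: ESL2_def GL2_def invertible_det_nz)
qed

end
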